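(* Let $K$ be a Cantor set with metric $d$. For every homeomorphism $T:K\to K$ and every $\varepsilon>0$ there exists a homeomorphism $\widetilde T:K\to K$ such that $D(T,\widetilde T)=\max_{x\in K} d(T(x),\widetilde T(x))<\varepsilon$ and, for every $x\in K$, the $\omega$-limit set of $x$ under $\widetilde T$ is a periodic orbit of $\widetilde T$.
   Context: A Cantor set is a nonempty totally disconnected, perfect, compact metric space. *)

theory Defs
  imports "HOL-Analysis.Analysis"
begin

definition totally_disconnected :: "'a::topological_space set \<Rightarrow> bool" where
  "totally_disconnected K \<longleftrightarrow> (\<forall>C. C \<subseteq> K \<and> connected C \<longrightarrow> (\<exists>a. C \<subseteq> {a}))"

definition perfect_set :: "'a::topological_space set \<Rightarrow> bool" where
  "perfect_set K \<longleftrightarrow> closed K \<and> (\<forall>x\<in>K. x islimpt K)"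

definition cantor_set :: "'a::metric_space set \<Rightarrow> bool" where
  "cantor_set K \<longleftrightarrow> K \<noteq> {} \<and> totally_disconnected K \<and> perfect_set K \<and> compact K"

definition omega_limit :: "('a::metric_space \<Rightarrow> 'a) \<Rightarrow> 'a \<Rightarrow> 'a set" where
  "omega_limit T x = {y. \<exists>r. strict_mono r \<and> (\<lambda>n. (T ^^ (r n)) x) \<longlonglongrightarrow> y}"

definition orbit :: "('a \<Rightarrow> 'a) \<Rightarrow> 'a \<Rightarrow> 'a set" where
  "orbit T p = {(T ^^ n) p | n. True}"

definition periodic_orbit :: "('a \<Rightarrow> 'a) \<Rightarrow> 'a set \<Rightarrow> bool" where
  "periodic_orbit T O' \<longleftrightarrow> (\<exists>p k. k > 0 \<and> (T ^^ k) p = p \<and> O' = orbit T p)"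

end

theory Submission
  imports Defs
begin

text \<open>
  Label the points of $K$ by a locally constant map with finitely many values and small fibres, and
  let $E$ be the finite graph of the label pairs of $x$ and $T x$. Any homeomorphism that sends each
  point with label pair $(i, j)$ to a point labelled $j$ is close to $T$. Choose for every label a
  successor $s$ and a predecessor $p$ in $E$. The bi-infinite paths in $E$ that follow $p$ backwards
  before some time, use an arbitrary edge at that time, and follow $s$ afterwards form, together
  with their limits, a compact shift space $Y$ meeting every edge, and all its points are forward
  asymptotic to periodic ones because $E$ is finite. The product $Y \times K$ is a Cantor set, as is
  the part of it above any edge, and any two Cantor sets are homeomorphic; so $Y \times K$ can be
  identified with $K$ respecting label pairs, and the shift times the identity becomes the desired map.
\<close>

section \<open>Clopen subsets of compact totally disconnected metric spaces\<close>

abbreviation clopenin :: "'a::topological_space set \<Rightarrow> 'a set \<Rightarrow> bool" where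
  "clopenin K U \<equiv> openin (top_of_set K) U \<and> closedin (top_of_set K) U"

lemma clopenin_Int: "clopenin K U \<Longrightarrow> clopenin K V \<Longrightarrow> clopenin K (U \<inter> V)"
  by (simp add: openin_Int closedin_Int)

lemma clopenin_Diff: "clopenin K U \<Longrightarrow> clopenin K V \<Longrightarrow> clopenin K (U - V)"
  by (simp add: openin_diff closedin_diff)

lemma eventually_at_within_openin:
  assumes "openin (top_of_set K) U" "x \<in> U"
  shows "\<forall>\<^sub>F y in at x within K. y \<in> U"
proof -
  obtain W where "open W" "U = K \<inter> W"
    using assms(1) by (auto simp: openin_open)
  then show ?thesis
    using assms(2) unfolding eventually_at_topological by blast
qed

text \<open>Closedness preserves compactness, and openness keeps every limit point of
  \<open>K\<close> in \<open>U\<close> a limit point of \<open>U\<close>.\<close>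

lemma cantor_set_clopenin:
  assumes K: "cantor_set K" and U: "clopenin K U" "U \<noteq> {}"
  shows "cantor_set U"
proof -
  have "U \<subseteq> K"
    using U(1) by (meson openin_imp_subset)
  have "compact U"
    using K U unfolding cantor_set_def by (meson closedin_compact)
  moreover have "x islimpt U" if "x \<in> U" for x
  proof -
    obtain W where W: "open W" "U = K \<inter> W"
      using U by (auto simp: openin_open)
    have "x islimpt K"
      using K \<open>U \<subseteq> K\<close> that unfolding cantor_set_def perfect_set_def by blast
    then show ?thesis
      using W that by (auto intro: islimpt_Int_eventually eventually_at_in_open')
  qed
  ultimately show ?thesis
    using K \<open>U \<subseteq> K\<close> U(2) unfolding cantor_set_def perfect_set_def totally_disconnected_def
    by (meson compact_imp_closed subset_trans)
qed

text \<open>The cut-wire-fence theorem: in a compact Hausdorff space, two closed sets that no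
  connected set joins lie on different sides of a clopen partition. Here connected sets have at most
  one point, so none joins \<open>x\<close> to the complement of the ball.\<close>

lemma small_clopenin_nhd:
  fixes K :: "'a::metric_space set"
  assumes "compact K" "totally_disconnected K" "x \<in> K" "e > 0"
  obtains U where "clopenin K U" "x \<in> U" "U \<subseteq> ball x e"
proof -
  have "separated_between (top_of_set K) {x} (K - ball x e)"
  proof (rule cut_wire_fence_theorem_gen)
    show "compact_space (top_of_set K)"
      using \<open>compact K\<close> by (simp add: compact_space_subtopology)
    show "Hausdorff_space (top_of_set K) \<or> regular_space (top_of_set K) \<or> normal_space (top_of_set K)"
      by (simp add: Hausdorff_space_subtopology)
    show "compactin (top_of_set K) {x}"
      using \<open>x \<in> K\<close> by simp
    show "closedin (top_of_set K) (K - ball x e)"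
      by (metis Diff_eq closed_Compl closedin_closed_Int open_ball)
    show "disjnt C {x} \<or> disjnt C (K - ball x e)" if "connectedin (top_of_set K) C" for C
    proof -
      have "connected C" "C \<subseteq> K"
        using that by (auto simp: connectedin_subtopology)
      then obtain a where "C \<subseteq> {a}"
        using \<open>totally_disconnected K\<close> unfolding totally_disconnected_def by blast
      then show ?thesis
        using \<open>e > 0\<close> by (cases "a = x") (auto simp: disjnt_def)
    qed
  qed
  then obtain U V where UV: "openin (top_of_set K) U" "openin (top_of_set K) V" "U \<union> V = K"
      "disjnt U V" "x \<in> U" "K - ball x e \<subseteq> V"
    unfolding separated_between_def by auto
  then have "U = K - V"
    by (auto simp: disjnt_def)
  then have "closedin (top_of_set K) U"
    using UV(2) by auto
  moreover have "U \<subseteq> ball x e"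
    using UV by (auto simp: disjnt_def)
  ultimately show ?thesis
    using UV that by blast
qed

lemma finite_small_clopenin_cover:
  fixes K :: "'a::metric_space set"
  assumes "compact K" "totally_disconnected K" "e > 0"
  obtains \<F> where "finite \<F>" "\<Union>\<F> = K" "\<And>U. U \<in> \<F> \<Longrightarrow> clopenin K U"
    "\<And>U x y. U \<in> \<F> \<Longrightarrow> x \<in> U \<Longrightarrow> y \<in> U \<Longrightarrow> dist x y < e"
proof -
  have "\<forall>x\<in>K. \<exists>U. clopenin K U \<and> x \<in> U \<and> U \<subseteq> ball x (e/2)"
    using small_clopenin_nhd[OF assms(1,2), of _ "e/2"] \<open>e > 0\<close> by (metis half_gt_zero)
  then obtain u where u: "\<And>x. x \<in> K \<Longrightarrow> clopenin K (u x) \<and> x \<in> u x \<and> u x \<subseteq> ball x (e/2)"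
    by metis
  have "\<forall>x\<in>K. \<exists>W. open W \<and> u x = K \<inter> W"
    using u by (simp add: openin_open)
  then obtain W where W: "\<And>x. x \<in> K \<Longrightarrow> open (W x) \<and> u x = K \<inter> W x"
    by metis
  have "K \<subseteq> (\<Union>x\<in>K. W x)"
    using u W by blast
  then obtain C where C: "C \<subseteq> K" "finite C" "K \<subseteq> (\<Union>x\<in>C. W x)"
    using compactE_image[OF \<open>compact K\<close>, of K W] W by metis
  show ?thesis
  proof
    show "finite (u ` C)"
      using C by simp
    have "K \<subseteq> \<Union>(u ` C)"
      using C W by fastforce
    moreover have "\<Union>(u ` C) \<subseteq> K"
      using C W by blast
    ultimately show "\<Union>(u ` C) = K"
      by blast
    show "clopenin K U" if "U \<in> u ` C" for U
      using that C u by blast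
    show "dist x y < e" if U: "U \<in> u ` C" and xy: "x \<in> U" "y \<in> U" for U x y
    proof -
      obtain c where "U \<subseteq> ball c (e/2)"
        using U C u by blast
      then show ?thesis
        using xy by (metis dist_commute dist_triangle_half_r mem_ball subset_iff)
    qed
  qed
qed

text \<open>The members of finite clopen covers of mesh \<open>1/(m+1)\<close>, taken over all
  \<open>m\<close>, form a countable family. Two distinct points cannot share a member once the mesh
  is below their distance.\<close>

lemma countable_clopenin_separating:
  fixes K :: "'a::metric_space set"
  assumes "compact K" "totally_disconnected K"
  obtains G :: "nat \<Rightarrow> 'a set" where "\<And>n. clopenin K (G n)"
    "\<And>x y. x \<in> K \<Longrightarrow> y \<in> K \<Longrightarrow> x \<noteq> y \<Longrightarrow> \<exists>n. x \<in> G n \<and> y \<notin> G n"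
proof -
  have "\<forall>m::nat. \<exists>\<F>. finite \<F> \<and> \<Union>\<F> = K \<and> (\<forall>U\<in>\<F>. clopenin K U) \<and>
      (\<forall>U\<in>\<F>. \<forall>x\<in>U. \<forall>y\<in>U. dist x y < inverse (Suc m))"
    using finite_small_clopenin_cover[OF assms, of "inverse (Suc _)"]
    by (metis inverse_positive_iff_positive of_nat_0_less_iff zero_less_Suc)
  then obtain F where F: "\<And>m::nat. finite (F m) \<and> \<Union>(F m) = K \<and> (\<forall>U\<in>F m. clopenin K U) \<and>
      (\<forall>U\<in>F m. \<forall>x\<in>U. \<forall>y\<in>U. dist x y < inverse (Suc m))"
    by metis
  \<comment> \<open>Adding the clopen set \<open>{}\<close> makes the family nonempty even for empty
    \<open>K\<close>, so that \<open>from_nat_into\<close> enumerates exactly its members.\<close>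
  define \<G> where "\<G> = insert {} (\<Union>m. F m)"
  have "countable \<G>" "\<G> \<noteq> {}"
    unfolding \<G>_def using F by (auto intro: countable_finite)
  then have rng: "range (from_nat_into \<G>) = \<G>"
    by (rule range_from_nat_into[rotated])
  show ?thesis
  proof
    show "clopenin K (from_nat_into \<G> n)" for n
    proof -
      have "from_nat_into \<G> n \<in> \<G>"
        using rng by blast
      then show ?thesis
        using F unfolding \<G>_def by auto
    qed
    show "\<exists>n. x \<in> from_nat_into \<G> n \<and> y \<notin> from_nat_into \<G> n"
      if xy: "x \<in> K" "y \<in> K" "x \<noteq> y" for x y
    proof -
      obtain m where m: "inverse (real (Suc m)) < dist x y"
        using xy reals_Archimedean by (metis zero_less_dist_iff)
      obtain U where U: "U \<in> F m" "x \<in> U"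
        using F xy by blast
      then have "y \<notin> U"
        using F m by (metis less_asym)
      moreover have "U \<in> range (from_nat_into \<G>)"
        using U rng \<G>_def by blast
      ultimately show ?thesis
        using U by blast
    qed
  qed
qed

text \<open>No point is isolated, so a small clopen neighbourhood of one point misses
  another.\<close>

lemma cantor_set_clopenin_split:
  assumes "cantor_set K"
  obtains U where "clopenin K U" "U \<noteq> {}" "K - U \<noteq> {}"
proof -
  obtain x where x: "x \<in> K"
    using assms unfolding cantor_set_def by blast
  then have "x islimpt K"
    using assms unfolding cantor_set_def perfect_set_def by blast
  then obtain y where y: "y \<in> K" "y \<noteq> x"
    unfolding islimpt_approachable by (meson zero_less_one)
  obtain U where "clopenin K U" "x \<in> U" "U \<subseteq> ball x (dist x y)"
    using small_clopenin_nhd[of K x "dist x y"] assms x y unfolding cantor_set_def by auto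
  then show ?thesis
    using that[of U] y by force
qed

section \<open>Uniqueness of the Cantor set up to homeomorphism\<close>

text \<open>The standard model of the Cantor set. Real digits place it in
  \<open>nat \<Rightarrow> real\<close> with the product topology.\<close>

definition zero_one_sequences :: "(nat \<Rightarrow> real) set" where
  "zero_one_sequences = {x. \<forall>n. x n \<in> {0, 1}}"

text \<open>At stage $n$ each cell is cut in two by the $n$-th member of a separating family if possible,
  and by an arbitrary clopen set otherwise; so no diameter estimate is needed.\<close>

theorem cantor_set_homeomorphic_zero_one_sequences:
  assumes K: "cantor_set K"
  shows "K homeomorphic zero_one_sequences"
proof -
  have "compact K" "totally_disconnected K" "K \<noteq> {}"
    using K unfolding cantor_set_def by auto
  then obtain G :: "nat \<Rightarrow> 'a set" where G: "\<And>n. clopenin K (G n)"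
    and sep: "\<And>x y. x \<in> K \<Longrightarrow> y \<in> K \<Longrightarrow> x \<noteq> y \<Longrightarrow> \<exists>n. x \<in> G n \<and> y \<notin> G n"
    using countable_clopenin_separating by metis
  have "\<exists>S. clopenin K S \<and> D \<inter> S \<noteq> {} \<and> D - S \<noteq> {} \<and>
      (D \<inter> G n \<noteq> {} \<longrightarrow> D - G n \<noteq> {} \<longrightarrow> S = G n)"
    if D: "clopenin K D" "D \<noteq> {}" for n D
  proof (cases "D \<inter> G n \<noteq> {} \<and> D - G n \<noteq> {}")
    case True
    then show ?thesis
      using G by blast
  next
    case False
    obtain U where U: "clopenin D U" "U \<noteq> {}" "D - U \<noteq> {}"
      using cantor_set_clopenin_split[OF cantor_set_clopenin[OF K D]] by metis
    then have "clopenin K U" "U \<subseteq> D"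
      by (meson D openin_trans closedin_trans openin_imp_subset)+
    then show ?thesis
      using U False by (metis inf.absorb_iff2)
  qed
  then have "\<forall>n D. \<exists>S. clopenin K D \<and> D \<noteq> {} \<longrightarrow> clopenin K S \<and> D \<inter> S \<noteq> {} \<and> D - S \<noteq> {} \<and>
      (D \<inter> G n \<noteq> {} \<longrightarrow> D - G n \<noteq> {} \<longrightarrow> S = G n)"
    by metis
  then obtain sp where sp: "\<And>n D. clopenin K D \<Longrightarrow> D \<noteq> {} \<Longrightarrow>
      clopenin K (sp n D) \<and> D \<inter> sp n D \<noteq> {} \<and> D - sp n D \<noteq> {} \<and>
      (D \<inter> G n \<noteq> {} \<longrightarrow> D - G n \<noteq> {} \<longrightarrow> sp n D = G n)"
    by metis
  \<comment> \<open>\<open>E x n\<close> is the cell reached by following the digits of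
    \<open>x\<close>, with digit 1 for the part inside \<open>sp n D\<close>. Dually,
    \<open>c a n\<close> is the cell found by tracking the point \<open>a\<close>, and
    \<open>h a\<close> is its itinerary.\<close>
  define E where "E x = rec_nat K (\<lambda>n D. if x n = (1::real) then D \<inter> sp n D else D - sp n D)" for x
  have E_0: "E x 0 = K" and
    E_Suc: "E x (Suc n) = (if x n = 1 then E x n \<inter> sp n (E x n) else E x n - sp n (E x n))" for x n
    by (simp_all add: E_def)
  define c where "c a = rec_nat K (\<lambda>n D. if a \<in> sp n D then D \<inter> sp n D else D - sp n D)" for a
  have c_0: "c a 0 = K" and
    c_Suc: "c a (Suc n) = (if a \<in> sp n (c a n) then c a n \<inter> sp n (c a n) else c a n - sp n (c a n))" for a n
    by (simp_all add: c_def)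
  define h where "h a n = (of_bool (a \<in> sp n (c a n)) :: real)" for a n
  have E: "clopenin K (E x n) \<and> E x n \<noteq> {}" for x n
  proof (induction n)
    case 0
    then show ?case
      using \<open>K \<noteq> {}\<close> by (simp add: E_0)
  next
    case (Suc n)
    then show ?case
      using sp[of "E x n" n] by (simp add: E_Suc clopenin_Int clopenin_Diff)
  qed
  have c_E: "c a n = E (h a) n" for a n
    by (induction n) (auto simp: E_0 c_0 c_Suc E_Suc h_def)
  have mem_c: "a \<in> c a n" if "a \<in> K" for a n
    using that by (induction n) (auto simp: c_0 c_Suc)
  \<comment> \<open>Points in one cell of stage \<open>n\<close> share their first \<open>n\<close>
    digits. As cells are open, every digit of \<open>h\<close> is locally constant, which yields
    continuity.\<close>
  have c_eq: "c b n = c a n \<and> (\<forall>m<n. h b m = h a m)" if "b \<in> c a n" for a b n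
    using that
  proof (induction n)
    case (Suc n)
    then show ?case
      by (auto simp: c_Suc h_def less_Suc_eq split: if_splits)
  qed (auto simp: c_0)
  have "continuous_on K h"
  proof (rule continuous_on_coordinatewise_then_product)
    fix n
    show "continuous_on K (\<lambda>a. h a n)"
      unfolding continuous_on_def
    proof
      fix a assume a: "a \<in> K"
      have "openin (top_of_set K) (c a (Suc n))" "a \<in> c a (Suc n)"
        using E c_E mem_c[OF a] by metis+
      then have "\<forall>\<^sub>F b in at a within K. b \<in> c a (Suc n)"
        by (rule eventually_at_within_openin)
      then have "\<forall>\<^sub>F b in at a within K. h b n = h a n"
        by eventually_elim (use c_eq in blast)
      then show "((\<lambda>a. h a n) \<longlongrightarrow> h a n) (at a within K)"
        by (rule tendsto_eventually)
    qed
  qed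
  moreover have "h ` K = zero_one_sequences"
  proof
    show "h ` K \<subseteq> zero_one_sequences"
      by (auto simp: zero_one_sequences_def h_def)
    show "zero_one_sequences \<subseteq> h ` K"
    proof
      fix x assume x: "x \<in> zero_one_sequences"
      \<comment> \<open>Surjectivity by compactness: the cells along \<open>x\<close> are nested,
        nonempty and closed, so they have a common point, and its itinerary is
        \<open>x\<close>.\<close>
      have "E x (Suc n) \<subseteq> E x n" for n
        by (auto simp: E_Suc)
      then have "decseq (E x)"
        by (simp add: decseq_Suc_iff)
      then have "(\<Inter>n. E x n) \<noteq> {}"
        using E \<open>compact K\<close>
        by (intro compact_space_imp_nest[of "top_of_set K"]) (auto simp: compact_space_subtopology)
      then obtain a where a: "\<And>n. a \<in> E x n"
        by blast
      have cE: "c a n = E x n" for n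
      proof (induction n)
        case (Suc n)
        then show ?case
          using a[of "Suc n"] by (auto simp: c_Suc E_Suc split: if_splits)
      qed (simp add: c_0 E_0)
      have "x n = h a n" for n
        using a[of "Suc n"] x by (auto simp: h_def cE E_Suc zero_one_sequences_def split: if_splits)
      moreover have "a \<in> K"
        using a[of 0] by (simp add: E_0)
      ultimately show "x \<in> h ` K"
        by (intro image_eqI[of _ _ a] ext)
    qed
  qed
  moreover have "inj_on h K"
  proof (rule inj_onI, rule ccontr)
    fix a b assume ab: "a \<in> K" "b \<in> K" "h a = h b" "a \<noteq> b"
    \<comment> \<open>Equal itineraries keep both points in one cell forever. At stage
      \<open>n\<close> that cell meets both \<open>G n\<close> and its complement, so it is cut
      along \<open>G n\<close>, and the digits differ.\<close>
    then obtain n where n: "a \<in> G n" "b \<notin> G n"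
      using sep by blast
    have cab: "c a n = c b n"
      by (simp add: c_E ab)
    then have "sp n (c a n) = G n"
      using mem_c[of a n] mem_c[of b n] ab n E[of "h a" n] sp[of "c a n" n] unfolding c_E by blast
    then have "h a n \<noteq> h b n"
      using n cab by (simp add: h_def)
    then show False
      using ab by simp
  qed
  ultimately show ?thesis
    using homeomorphic_compact[OF \<open>compact K\<close>] by blast
qed

corollary cantor_sets_homeomorphic:
  assumes "cantor_set K" "cantor_set L"
  shows "K homeomorphic L"
  using assms cantor_set_homeomorphic_zero_one_sequences homeomorphic_sym homeomorphic_trans
  by metis

section \<open>Label-preserving homeomorphisms and products of Cantor sets\<close>

lemma clopenin_fibre:
  fixes f :: "'a::topological_space \<Rightarrow> 'b::t1_space"
  assumes "continuous_on X f" "finite (f ` X)"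
  shows "clopenin X {x \<in> X. f x = e}"
proof
  \<comment> \<open>Removing the finitely many other values leaves an open set, so the fibre is open
    as well as closed.\<close>
  have "{x \<in> X. f x = e} = X \<inter> f -` (- (f ` X - {e}))"
    by auto
  moreover have "open (- (f ` X - {e}))"
    using assms(2) by (meson finite_Diff finite_imp_closed open_Compl)
  ultimately show "openin (top_of_set X) {x \<in> X. f x = e}"
    using continuous_openin_preimage_gen[OF assms(1)] by simp
  have "{x \<in> X. f x = e} = X \<inter> f -` {e}"
    by auto
  then show "closedin (top_of_set X) {x \<in> X. f x = e}"
    using continuous_closedin_preimage[OF assms(1) closed_singleton[of e]] by simp
qed

text \<open>Corresponding fibres are nonempty clopen subsets of Cantor sets, hence homeomorphic. The
  fibrewise homeomorphisms glue because the fibres are clopen.\<close>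

lemma cantor_set_homeomorphism_over_labels:
  fixes X :: "'a::metric_space set" and L :: "'b::metric_space set" and f :: "'a \<Rightarrow> 'c::t1_space"
  assumes X: "cantor_set X" "continuous_on X f" and L: "cantor_set L" "continuous_on L g"
    and fin: "finite (f ` X)" and img: "f ` X = g ` L"
  obtains \<phi> \<psi> where "homeomorphism X L \<phi> \<psi>" "\<And>x. x \<in> X \<Longrightarrow> g (\<phi> x) = f x"
proof -
  define F where "F e = {x \<in> X. f x = e}" for e
  define H where "H e = {x \<in> L. g x = e}" for e
  have F: "clopenin X (F e)" for e
    unfolding F_def using X(2) fin by (rule clopenin_fibre)
  have H: "clopenin L (H e)" for e
    unfolding H_def using L(2) fin[unfolded img] by (rule clopenin_fibre)
  have "\<exists>\<phi> \<psi>. homeomorphism (F e) (H e) \<phi> \<psi>" if "e \<in> f ` X" for e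
  proof -
    have "F e \<noteq> {}"
      using that unfolding F_def by blast
    moreover have "H e \<noteq> {}"
      using that unfolding H_def img by blast
    ultimately have "F e homeomorphic H e"
      using cantor_sets_homeomorphic[OF cantor_set_clopenin[OF X(1) F] cantor_set_clopenin[OF L(1) H]]
      by blast
    then show ?thesis
      by (simp add: homeomorphic_def)
  qed
  then obtain \<Phi> \<Psi> where \<Phi>: "\<And>e. e \<in> f ` X \<Longrightarrow> homeomorphism (F e) (H e) (\<Phi> e) (\<Psi> e)"
    by metis
  define \<phi> where "\<phi> x = \<Phi> (f x) x" for x
  have \<phi>_H: "\<phi> x \<in> H (f x)" if "x \<in> X" for x
    using homeomorphism_image1[OF \<Phi>[of "f x"]] that unfolding \<phi>_def F_def by auto
  have "continuous_on X \<phi>"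
    unfolding continuous_on_def
  proof
    fix x assume x: "x \<in> X"
    have "openin (top_of_set X) (F (f x))" "x \<in> F (f x)"
      using F x by (auto simp: F_def)
    then have ev: "\<forall>\<^sub>F y in at x within X. y \<in> F (f x)"
      by (rule eventually_at_within_openin)
    obtain W where W: "open W" "F (f x) = X \<inter> W"
      using F by (meson openin_open)
    \<comment> \<open>As the fibre is open in \<open>X\<close>, limits within it and within
      \<open>X\<close> agree, so continuity of \<open>\<Phi> (f x)\<close> passes to
      \<open>\<phi>\<close>.\<close>
    have at_eq: "at x within F (f x) = at x within X"
      using W \<open>x \<in> F (f x)\<close> by (intro at_within_nhd[of x W]) auto
    have "(\<Phi> (f x) \<longlongrightarrow> \<Phi> (f x) x) (at x within F (f x))"
      using homeomorphism_cont1[OF \<Phi>[of "f x"]] x by (auto simp: continuous_on_def F_def)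
    then have "(\<Phi> (f x) \<longlongrightarrow> \<phi> x) (at x within X)"
      unfolding at_eq \<phi>_def .
    moreover have "\<forall>\<^sub>F y in at x within X. \<Phi> (f x) y = \<phi> y"
      using ev by eventually_elim (simp add: F_def \<phi>_def)
    ultimately show "(\<phi> \<longlongrightarrow> \<phi> x) (at x within X)"
      by (rule Lim_transform_eventually)
  qed
  moreover have "\<phi> ` X = L"
  proof
    show "\<phi> ` X \<subseteq> L"
      using \<phi>_H by (auto simp: H_def)
    show "L \<subseteq> \<phi> ` X"
    proof
      fix y assume y: "y \<in> L"
      then have "g y \<in> f ` X" "y \<in> H (g y)"
        unfolding img by (auto simp: H_def)
      then have "y \<in> \<Phi> (g y) ` F (g y)"
        using homeomorphism_image1[OF \<Phi>] by metis
      then show "y \<in> \<phi> ` X"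
        unfolding \<phi>_def F_def by force
    qed
  qed
  moreover have "inj_on \<phi> X"
  proof (rule inj_onI)
    fix x y assume xy: "x \<in> X" "y \<in> X" "\<phi> x = \<phi> y"
    then have fxy: "f x = f y"
      using \<phi>_H[of x] \<phi>_H[of y] by (simp add: H_def)
    have "homeomorphism (F (f x)) (H (f x)) (\<Phi> (f x)) (\<Psi> (f x))" "x \<in> F (f x)" "y \<in> F (f x)"
      using \<Phi> xy fxy by (auto simp: F_def)
    then show "x = y"
      using xy(3) unfolding \<phi>_def fxy by (metis homeomorphism_apply1)
  qed
  moreover have "compact X"
    using X unfolding cantor_set_def by blast
  ultimately obtain \<psi> where "homeomorphism X L \<phi> \<psi>"
    using homeomorphism_compact by metis
  moreover have "g (\<phi> x) = f x" if "x \<in> X" for x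
    using \<phi>_H[OF that] by (simp add: H_def)
  ultimately show ?thesis
    using that by blast
qed

text \<open>The factor \<open>K\<close> supplies the limit points: any point is approached by
  changing its second coordinate only. This turns a path space that may have isolated points into a
  Cantor set.\<close>

lemma cantor_set_Times:
  fixes Y :: "'a::metric_space set" and K :: "'b::metric_space set"
  assumes Y: "compact Y" "totally_disconnected Y" "Y \<noteq> {}" and K: "cantor_set K"
  shows "cantor_set (Y \<times> K)"
proof -
  have "compact (Y \<times> K)"
    using Y K unfolding cantor_set_def by (simp add: compact_Times)
  moreover have "z islimpt (Y \<times> K)" if zYK: "z \<in> Y \<times> K" for z
  proof -
    obtain y x where z: "z = (y, x)" "y \<in> Y" "x \<in> K"
      using zYK by blast
    then have "x islimpt K"
      using K unfolding cantor_set_def perfect_set_def by blast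
    show ?thesis
      unfolding islimpt_approachable
    proof (intro allI impI)
      fix e :: real assume "e > 0"
      then obtain x' where "x' \<in> K" "x' \<noteq> x" "dist x' x < e"
        using \<open>x islimpt K\<close> unfolding islimpt_approachable by blast
      then show "\<exists>z'\<in>Y \<times> K. z' \<noteq> z \<and> dist z' z < e"
        using z by (intro bexI[of _ "(y, x')"]) (auto simp: dist_Pair_Pair)
    qed
  qed
  moreover have "\<exists>z. C \<subseteq> {z}" if C: "C \<subseteq> Y \<times> K" "connected C" for C
  proof -
    have "connected (fst ` C)" "connected (snd ` C)"
      using C by (auto intro!: connected_continuous_image continuous_intros)
    moreover have "fst ` C \<subseteq> Y" "snd ` C \<subseteq> K"
      using C by auto
    ultimately obtain a b where "fst ` C \<subseteq> {a}" "snd ` C \<subseteq> {b}"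
      using Y K unfolding cantor_set_def totally_disconnected_def by metis
    then have "C \<subseteq> {(a, b)}"
      by force
    then show ?thesis ..
  qed
  ultimately show ?thesis
    using Y K unfolding cantor_set_def perfect_set_def totally_disconnected_def
    by (auto intro: compact_imp_closed)
qed

section \<open>Omega-limit sets of asymptotically periodic points\<close>

text \<open>Along any subsequence the orbits of \<open>x\<close> and \<open>p\<close> have the same
  limits, and those of \<open>p\<close> stay in its orbit, which is finite and hence closed.\<close>

lemma omega_limit_eq_orbit_if_asymptotic:
  fixes T :: "'a::metric_space \<Rightarrow> 'a"
  assumes k: "k > 0" "(T ^^ k) p = p"
    and lim: "(\<lambda>n. dist ((T ^^ n) x) ((T ^^ n) p)) \<longlonglongrightarrow> 0"
  shows "omega_limit T x = orbit T p"
proof -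
  have mult: "(T ^^ (n * k)) p = p" for n
    by (induction n) (simp_all add: funpow_add k)
  have "(T ^^ n) p = (T ^^ (n mod k)) p" for n
    by (metis comp_apply div_mult_mod_eq add.commute funpow_add mult)
  then have "orbit T p \<subseteq> (\<lambda>n. (T ^^ n) p) ` {..<k}"
    using k unfolding orbit_def by (auto intro!: image_eqI[of _ _ "_ mod k"])
  then have closed: "closed (orbit T p)"
    by (meson finite_imageI finite_imp_closed finite_lessThan finite_subset)
  show ?thesis
  proof
    show "omega_limit T x \<subseteq> orbit T p"
    proof
      fix y assume "y \<in> omega_limit T x"
      then obtain r where r: "strict_mono r" "(\<lambda>n. (T ^^ (r n)) x) \<longlonglongrightarrow> y"
        unfolding omega_limit_def by blast
      have "(\<lambda>n. dist ((T ^^ r n) x) ((T ^^ r n) p)) \<longlonglongrightarrow> 0"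
        using LIMSEQ_subseq_LIMSEQ[OF lim r(1)] by (simp add: o_def)
      moreover have "(\<lambda>n. dist ((T ^^ r n) x) y) \<longlonglongrightarrow> 0"
        using r(2) by (simp add: tendsto_dist_iff[of _ y])
      ultimately have "(\<lambda>n. dist ((T ^^ r n) x) ((T ^^ r n) p) + dist ((T ^^ r n) x) y) \<longlonglongrightarrow> 0"
        by (rule tendsto_add_zero)
      then have "(\<lambda>n. dist ((T ^^ r n) p) y) \<longlonglongrightarrow> 0"
        by (rule tendsto_sandwich[OF _ _ tendsto_const, rotated 2])
          (auto intro!: always_eventually dist_triangle3)
      then have "(\<lambda>n. (T ^^ (r n)) p) \<longlonglongrightarrow> y"
        by (simp add: tendsto_dist_iff[of _ y])
      then show "y \<in> orbit T p"
        by (rule closed_sequentially[OF closed, rotated]) (auto simp: orbit_def)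
    qed
    show "orbit T p \<subseteq> omega_limit T x"
    proof
      fix y assume "y \<in> orbit T p"
      then obtain m where y: "y = (T ^^ m) p"
        unfolding orbit_def by blast
      \<comment> \<open>These are times at which the orbit of \<open>p\<close> visits
        \<open>y\<close>, so the orbit of \<open>x\<close> converges to \<open>y\<close> along
        them.\<close>
      define r where "r n = m + n * k" for n
      have r: "strict_mono r"
        using k by (auto simp: strict_mono_def r_def)
      have "(T ^^ r n) p = y" for n
        by (simp add: r_def funpow_add mult y)
      then have "(\<lambda>n. dist ((T ^^ r n) x) y) \<longlonglongrightarrow> 0"
        using LIMSEQ_subseq_LIMSEQ[OF lim r] by (simp add: o_def)
      then have "(\<lambda>n. (T ^^ r n) x) \<longlonglongrightarrow> y"
        by (simp add: tendsto_dist_iff[of _ y])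
      then show "y \<in> omega_limit T x"
        using r unfolding omega_limit_def by blast
    qed
  qed
qed

section \<open>The shift on paths guided by a successor and a predecessor map\<close>

definition shift :: "(int \<Rightarrow> 'a) \<Rightarrow> int \<Rightarrow> 'a" where
  "shift y k = y (k + 1)"

lemma funpow_shift: "(shift ^^ n) y k = y (k + int n)"
  by (induction n arbitrary: k) (simp_all add: shift_def ac_simps)

lemma continuous_on_shift: "continuous_on A (shift :: (int \<Rightarrow> 'a::topological_space) \<Rightarrow> _)"
  unfolding shift_def[abs_def]
  by (intro continuous_on_coordinatewise_then_product)
    (rule continuous_on_subset[OF continuous_on_product_coordinates subset_UNIV])

lemma shift_asymptotic:
  fixes y w :: "int \<Rightarrow> 'a::metric_space"
  assumes "\<And>k. k \<ge> N \<Longrightarrow> y k = w k"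
  shows "(\<lambda>n. dist ((shift ^^ n) y) ((shift ^^ n) w)) \<longlonglongrightarrow> 0"
proof (rule LIMSEQ_I)
  fix r :: real assume "r > 0"
  then obtain M where M: "(1/2::real) ^ M < r"
    using real_arch_pow_inv[of r "1/2"] by auto
  \<comment> \<open>The product metric is controlled by the first \<open>M + 1\<close> coordinates
    in the enumeration \<open>from_nat\<close>, up to an error \<open>(1/2)^M\<close>. From time
    \<open>n0\<close> on, all these coordinates have been shifted to indices at least
    \<open>N\<close>, where \<open>y\<close> and \<open>w\<close> agree.\<close>
  define n0 where "n0 = nat (N + (\<Sum>i\<le>M. \<bar>from_nat i :: int\<bar>))"
  have "dist ((shift ^^ n) y) ((shift ^^ n) w) < r" if "n \<ge> n0" for n
  proof -
    have "dist ((shift ^^ n) y (from_nat i)) ((shift ^^ n) w (from_nat i)) = 0" if "i \<le> M" for i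
    proof -
      have "\<bar>from_nat i :: int\<bar> \<le> (\<Sum>i\<le>M. \<bar>from_nat i :: int\<bar>)"
        using that by (intro member_le_sum) auto
      then have "from_nat i + int n \<ge> N"
        using \<open>n \<ge> n0\<close> unfolding n0_def by linarith
      then show ?thesis
        using assms by (simp add: funpow_shift)
    qed
    then have "{dist ((shift ^^ n) y (from_nat i)) ((shift ^^ n) w (from_nat i)) |i. i \<le> M} = {0}"
      by (auto intro!: exI[of _ 0])
    then show ?thesis
      using dist_fun_le_dist_first_terms[of "(shift ^^ n) y" "(shift ^^ n) w" M] M by simp
  qed
  then show "\<exists>no. \<forall>n\<ge>no. norm (dist ((shift ^^ n) y) ((shift ^^ n) w) - 0) < r"
    by auto
qed

text \<open>Stated pairwise in $k < l$, the condition defining these paths is closed without adding limits: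
  a step that is not a $p$-step forces all later steps to be $s$-steps.\<close>

definition guided_paths ::
    "('v \<times> 'v) set \<Rightarrow> ('v \<Rightarrow> 'v) \<Rightarrow> ('v \<Rightarrow> 'v) \<Rightarrow> (int \<Rightarrow> 'v) set" where
  "guided_paths E s p = {y. (\<forall>k. (y k, y (k + 1)) \<in> E) \<and>
     (\<forall>k l. k < l \<longrightarrow> y k = p (y (k + 1)) \<or> y (l + 1) = s (y l))}"

text \<open>The defining conditions quantify over all times, so they are invariant under translation
  by any integer, in particular by 1 and by -1.\<close>

lemma shift_guided_paths: "shift ` guided_paths E s p = guided_paths E s p"
proof
  have *: "(\<lambda>k. y (k + c)) \<in> guided_paths E s p" if y: "y \<in> guided_paths E s p" for y and c :: int
    unfolding guided_paths_def mem_Collect_eq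
  proof (intro conjI allI impI)
    show "(y (k + c), y (k + 1 + c)) \<in> E" for k
      using y unfolding guided_paths_def by (metis (mono_tags, lifting) add.assoc add.commute mem_Collect_eq)
    show "y (k + c) = p (y (k + 1 + c)) \<or> y (l + 1 + c) = s (y (l + c))" if "k < l" for k l
    proof -
      have "k + c < l + c"
        using that by simp
      then have "y (k + c) = p (y (k + c + 1)) \<or> y (l + c + 1) = s (y (l + c))"
        using y unfolding guided_paths_def by blast
      then show ?thesis
        by (simp add: ac_simps)
    qed
  qed
  show "shift ` guided_paths E s p \<subseteq> guided_paths E s p"
    using *[of _ 1] by (auto simp: shift_def[abs_def])
  show "guided_paths E s p \<subseteq> shift ` guided_paths E s p"
  proof
    fix y assume "y \<in> guided_paths E s p"
    then have "(\<lambda>k. y (k + - 1)) \<in> guided_paths E s p"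
      by (rule *)
    moreover have "y = shift (\<lambda>k. y (k + - 1))"
      by (simp add: shift_def fun_eq_iff)
    ultimately show "y \<in> shift ` guided_paths E s p"
      by (metis image_eqI)
  qed
qed

text \<open>Each condition involves finitely many coordinates with values restricted to finite sets
  of edges, so it is closed. All paths lie in a product of finite sets, compact by Tychonoff's
  theorem.\<close>

lemma compact_guided_paths:
  fixes E :: "('v::metric_space \<times> 'v) set"
  assumes "finite E"
  shows "compact (guided_paths E s p)"
proof -
  define P where "P = {(i, j) \<in> E. i = p j}"
  define S where "S = {(i, j) \<in> E. j = s i}"
  have cl: "closed {y. (y k, y (k + 1)) \<in> F}" if "F \<subseteq> E" for F and k :: int
  proof -
    have "closed F"
      using assms that by (meson finite_imp_closed finite_subset)
    moreover have "continuous_on UNIV (\<lambda>y::int \<Rightarrow> 'v. (y k, y (k + 1)))"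
      by (intro continuous_on_Pair continuous_on_product_coordinates)
    ultimately show ?thesis
      using closed_vimage[of F "\<lambda>y::int \<Rightarrow> 'v. (y k, y (k + 1))"] by (simp add: vimage_def)
  qed
  have eq: "guided_paths E s p = {y. \<forall>k. (y k, y (k + 1)) \<in> E} \<inter>
      {y. \<forall>k l. k < l \<longrightarrow> (y k, y (k + 1)) \<in> P \<or> (y l, y (l + 1)) \<in> S}"
    unfolding guided_paths_def P_def S_def by auto
  have "P \<subseteq> E" "S \<subseteq> E"
    unfolding P_def S_def by auto
  then have "closed (guided_paths E s p)"
    unfolding eq
    by (intro closed_Int closed_Collect_all closed_Collect_imp closed_Collect_disj cl open_Collect_const) auto
  moreover have "compact (PiE UNIV (\<lambda>_::int. fst ` E))"
    using compactin_PiE[of "\<lambda>_. euclidean" "UNIV :: int set" "\<lambda>_. fst ` E"] assms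
    by (simp add: euclidean_product_topology finite_imp_compact)
  moreover have "guided_paths E s p \<subseteq> PiE UNIV (\<lambda>_. fst ` E)"
    unfolding guided_paths_def by force
  ultimately show ?thesis
    by (metis compact_Int_closed inf.absorb_iff2 inf_commute)
qed

text \<open>Each coordinate takes finitely many values, so it is constant on connected sets.\<close>

lemma totally_disconnected_guided_paths:
  fixes E :: "('v::metric_space \<times> 'v) set"
  assumes "finite E"
  shows "totally_disconnected (guided_paths E s p)"
  unfolding totally_disconnected_def
proof (intro allI impI)
  fix C assume C: "C \<subseteq> guided_paths E s p \<and> connected C"
  have eq: "y k = z k" if yz: "y \<in> C" "z \<in> C" for y z k
  proof -
    have "connected ((\<lambda>y. y k) ` C)"
      using C continuous_on_subset[OF continuous_on_product_coordinates[of k] subset_UNIV]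
      by (auto intro: connected_continuous_image)
    moreover have "(\<lambda>y. y k) ` C \<subseteq> fst ` E"
      using C unfolding guided_paths_def by force
    then have "finite ((\<lambda>y. y k) ` C)"
      using assms by (meson finite_imageI finite_subset)
    ultimately have "(\<lambda>y. y k) ` C = {} \<or> (\<exists>a. (\<lambda>y. y k) ` C = {a})"
      using connected_finite_iff_sing[of "(\<lambda>y. y k) ` C"] by simp
    then obtain a where "(\<lambda>y. y k) ` C \<subseteq> {a}"
      by blast
    then show ?thesis
      using yz by auto
  qed
  show "\<exists>a. C \<subseteq> {a}"
  proof (cases "C = {}")
    case False
    then obtain z where "z \<in> C"
      by blast
    then have "C \<subseteq> {z}"
      using eq by (auto simp: fun_eq_iff)
    then show ?thesis
      by blast
  qed auto
qed

lemma guided_path_through_edge: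
  assumes ij: "(i, j) \<in> E"
    and s: "\<And>i j. (i, j) \<in> E \<Longrightarrow> (j, s j) \<in> E"
    and p: "\<And>i j. (i, j) \<in> E \<Longrightarrow> (p i, i) \<in> E"
  obtains y where "y \<in> guided_paths E s p" "y 0 = i" "y 1 = j"
proof -
  \<comment> \<open>Follow \<open>p\<close> backwards from \<open>i\<close> at time 0 and
    \<open>s\<close> forwards from \<open>j\<close> at time 1. Only the step from time 0 to time 1
    is arbitrary.\<close>
  define y where "y k = (if k \<le> 0 then (p ^^ nat (- k)) i else (s ^^ nat (k - 1)) j)" for k :: int
  have p_step: "y k = p (y (k + 1))" if "k < 0" for k
  proof -
    have "nat (- k) = Suc (nat (- (k + 1)))"
      using that by simp
    then show ?thesis
      using that by (simp add: y_def)
  qed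
  have s_step: "y (k + 1) = s (y k)" if "k > 0" for k
  proof -
    have "nat (k + 1 - 1) = Suc (nat (k - 1))"
      using that by simp
    then show ?thesis
      using that by (simp add: y_def)
  qed
  have pE: "((p ^^ Suc n) i, (p ^^ n) i) \<in> E" for n
    by (induction n) (use p ij in auto)
  have sE: "((s ^^ n) j, (s ^^ Suc n) j) \<in> E" for n
    by (induction n) (use s ij in auto)
  have "(y k, y (k + 1)) \<in> E" for k
  proof -
    consider "k < 0" | "k = 0" | "k > 0"
      by linarith
    then show ?thesis
    proof cases
      case 1
      then show ?thesis
        using p_step[OF 1] pE[of "nat (- (k + 1))"] by (simp add: y_def)
    next
      case 3
      then show ?thesis
        using s_step[OF 3] sE[of "nat (k - 1)"] by (simp add: y_def)
    qed (use ij in \<open>simp add: y_def\<close>)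
  qed
  \<comment> \<open>For \<open>k < l\<close>, either \<open>k < 0\<close>, giving a
    \<open>p\<close>-step at \<open>k\<close>, or \<open>l > 0\<close>, giving an
    \<open>s\<close>-step at \<open>l\<close>.\<close>
  moreover have "y k = p (y (k + 1)) \<or> y (l + 1) = s (y l)" if "k < l" for k l
    using p_step s_step that by (meson linorder_not_le order_le_less_trans)
  ultimately have "y \<in> guided_paths E s p"
    unfolding guided_paths_def by blast
  then show ?thesis
    using that by (simp add: y_def)
qed

text \<open>A path either follows \<open>p\<close> throughout or follows \<open>s\<close> from some
  time on. By finiteness some vertex recurs infinitely often, and a deterministic rule then repeats
  the block between two visits.\<close>

lemma guided_path_eventually_periodic:
  assumes "finite E" and y: "y \<in> guided_paths E s p"
  obtains N and m :: nat where "m > 0" "\<And>k. k \<ge> N \<Longrightarrow> y (k + int m) = y k"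
proof -
  have "range (\<lambda>n. y (int n)) \<subseteq> fst ` E"
    using y unfolding guided_paths_def by force
  then have "finite (range (\<lambda>n. y (int n)))"
    using assms by (meson finite_imageI finite_subset)
  then obtain n where "infinite {n' \<in> UNIV. y (int n') = y (int n)}"
    using pigeonhole_infinite[of UNIV "\<lambda>n. y (int n)"] by auto
  then obtain a where "infinite {n. y (int n) = a}"
    by auto
  then have a: "\<exists>n>b. y (int n) = a" for b
    unfolding infinite_nat_iff_unbounded by blast
  show ?thesis
  proof (cases "\<forall>k. y k = p (y (k + 1))")
    case True
    have y_p: "y (k - int n) = (p ^^ n) (y k)" for k n
    proof (induction n)
      case (Suc n)
      have "y (k - int (Suc n)) = p (y (k - int (Suc n) + 1))"
        using True by blast
      then show ?case
        using Suc by (simp add: algebra_simps)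
    qed simp
    obtain n1 where n1: "y (int n1) = a"
      using a by blast
    obtain n2 where n2: "n2 > n1" "y (int n2) = a"
      using a by blast
    define m where "m = n2 - n1"
    have pa: "(p ^^ m) a = a"
      using y_p[of "int n2" m] n1 n2 by (simp add: m_def of_nat_diff)
    have "y (k + int m) = y k" for k
    proof -
      \<comment> \<open>As \<open>p\<close> runs backwards in time, start at a visit to
        \<open>a\<close> later than \<open>k + m\<close>. Going \<open>j\<close> steps back from it
        reaches \<open>k + m\<close>, and \<open>m\<close> further steps reach \<open>k\<close>;
        those extra steps cost nothing since \<open>p ^^ m\<close> fixes \<open>a\<close>.\<close>
      obtain n where n: "n > nat (k + int m)" "y (int n) = a"
        using a by blast
      define j where "j = nat (int n - k - int m)"
      have j: "int n - int j = k + int m" "int n - int (j + m) = k"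
        using n unfolding j_def by linarith+
      have "y k = (p ^^ j) ((p ^^ m) a)"
        using y_p[of "int n" "j + m"] unfolding j n(2) by (simp add: funpow_add)
      also have "\<dots> = y (k + int m)"
        using y_p[of "int n" j] unfolding j n(2) pa by simp
      finally show ?thesis ..
    qed
    then show ?thesis
      using that[of m] n2 by (simp add: m_def)
  next
    case False
    then obtain k0 where "y k0 \<noteq> p (y (k0 + 1))"
      by blast
    then have s_step: "y (l + 1) = s (y l)" if "k0 < l" for l
      using y that unfolding guided_paths_def by blast
    have y_s: "y (k + int n) = (s ^^ n) (y k)" if "k > k0" for k n
    proof (induction n)
      case (Suc n)
      then show ?case
        using s_step[of "k + int n"] that by (simp add: algebra_simps)
    qed simp
    obtain n1 where n1: "n1 > nat k0" "y (int n1) = a"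
      using a by blast
    obtain n2 where n2: "n2 > n1" "y (int n2) = a"
      using a by blast
    define m where "m = n2 - n1"
    have "y (k + int m) = y k" if "k \<ge> int n1" for k
    proof -
      define j where "j = nat (k - int n1)"
      have j: "int n1 + int j = k" "int n2 + int j = k + int m"
        using that n2 unfolding j_def m_def by linarith+
      have "y k = (s ^^ j) a" "y (k + int m) = (s ^^ j) a"
        using y_s[of "int n1" j] y_s[of "int n2" j] n1 n2 unfolding j by simp_all
      then show ?thesis
        by simp
    qed
    then show ?thesis
      using that[of m "int n1"] n2 by (simp add: m_def)
  qed
qed

text \<open>The periodic companion \<open>w\<close> must itself be a guided path, so that a
  homeomorphism defined on the path space can be applied to it.\<close>

lemma guided_path_asymptotic_periodic:
  assumes "finite E" and y: "y \<in> guided_paths E s p"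
  obtains w N and m :: nat where "w \<in> guided_paths E s p" "m > 0" "(shift ^^ m) w = w"
    "\<And>k. k \<ge> N \<Longrightarrow> y k = w k"
proof -
  obtain N and m :: nat where m: "m > 0" and per: "\<And>k. k \<ge> N \<Longrightarrow> y (k + int m) = y k"
    using guided_path_eventually_periodic[OF assms] by metis
  have per_mult: "y (k + int t * int m) = y k" if "k \<ge> N" for k t
  proof (induction t)
    case (Suc t)
    then show ?case
      using per[of "k + int t * int m"] that by (simp add: algebra_simps add_increasing2)
  qed simp
  \<comment> \<open>Repeat the block of length \<open>m\<close> starting at \<open>N\<close> in both
    directions.\<close>
  define w where "w k = y (N + (k - N) mod int m)" for k
  have w_y: "w k = y k" if "k \<ge> N" for k
  proof -
    have "k = N + (k - N) mod int m + int (nat ((k - N) div int m)) * int m"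
      using that m by (simp add: pos_imp_zdiv_nonneg_iff)
    then show ?thesis
      using per_mult[of "N + (k - N) mod int m" "nat ((k - N) div int m)"] m unfolding w_def by simp
  qed
  have w_mult: "w (k + int t * int m) = w k" for k t
    by (simp add: w_def diff_add_eq[symmetric])
  \<comment> \<open>Any condition on \<open>w\<close> can be moved by a multiple \<open>c\<close> of
    the period to times beyond \<open>N\<close>, where \<open>w\<close> coincides with
    \<open>y\<close>.\<close>
  have far: "\<exists>c\<ge>0. k + c \<ge> N \<and> (\<forall>k. w (k + c) = w k)" for k
  proof -
    have "int (nat (N - k)) * int m \<ge> int (nat (N - k))"
      using m by (simp add: mult_le_cancel_left1)
    then show ?thesis
      using w_mult[of _ "nat (N - k)"] by (intro exI[of _ "int (nat (N - k)) * int m"] conjI allI) linarith+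
  qed
  have "w \<in> guided_paths E s p"
    unfolding guided_paths_def mem_Collect_eq
  proof (intro conjI allI impI)
    show "(w k, w (k + 1)) \<in> E" for k
    proof -
      obtain c where c: "k + c \<ge> N" "\<And>k. w (k + c) = w k"
        using far by blast
      have "(y (k + c), y (k + c + 1)) \<in> E"
        using y unfolding guided_paths_def by blast
      then show ?thesis
        using c(1) c(2)[of k] c(2)[of "k + 1"] w_y[of "k + c"] w_y[of "k + c + 1"] by (simp add: ac_simps)
    qed
    show "w k = p (w (k + 1)) \<or> w (l + 1) = s (w l)" if "k < l" for k l
    proof -
      obtain c where c: "k + c \<ge> N" "\<And>k. w (k + c) = w k"
        using far by blast
      have "y (k + c) = p (y (k + c + 1)) \<or> y (l + c + 1) = s (y (l + c))"
        using y that unfolding guided_paths_def by simp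
      then show ?thesis
        using c(1) that c(2)[of k] c(2)[of "k + 1"] c(2)[of l] c(2)[of "l + 1"]
          w_y[of "k + c"] w_y[of "k + c + 1"] w_y[of "l + c"] w_y[of "l + c + 1"]
        by (simp add: ac_simps)
    qed
  qed
  moreover have "(shift ^^ m) w = w"
    using w_mult[of _ 1] by (simp add: fun_eq_iff funpow_shift)
  ultimately show ?thesis
    using that[of w m N] m w_y by simp
qed

section \<open>Locally constant labels with small fibres\<close>

text \<open>The covering sets may overlap, so points are classified by the collection of sets
  containing them. A chosen point of each class serves as its label, which keeps the labels in the
  metric type \<open>'a\<close>, as the path space requires.\<close>

lemma finite_clopen_labelling:
  fixes K :: "'a::metric_space set"
  assumes "compact K" "totally_disconnected K" "e > 0"
  obtains lab :: "'a \<Rightarrow> 'a" where "continuous_on K lab" "finite (lab ` K)"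
    "\<And>x y. x \<in> K \<Longrightarrow> y \<in> K \<Longrightarrow> lab x = lab y \<Longrightarrow> dist x y < e"
proof -
  obtain \<F> where \<F>: "finite \<F>" "\<Union>\<F> = K" "\<And>U. U \<in> \<F> \<Longrightarrow> clopenin K U"
    "\<And>U x y. U \<in> \<F> \<Longrightarrow> x \<in> U \<Longrightarrow> y \<in> U \<Longrightarrow> dist x y < e"
    using finite_small_clopenin_cover[OF assms] by metis
  define cls where "cls x = {U \<in> \<F>. x \<in> U}" for x
  define lab where "lab x = (SOME y. y \<in> K \<and> cls y = cls x)" for x
  have lab: "cls (lab x) = cls x" if "x \<in> K" for x
    unfolding lab_def using someI[of "\<lambda>y. y \<in> K \<and> cls y = cls x" x] that by blast
  have lab_cong: "cls x = cls y \<Longrightarrow> lab x = lab y" for x y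
    by (simp add: lab_def)
  show ?thesis
  proof
    have "lab ` K \<subseteq> (\<lambda>c. SOME y. y \<in> K \<and> cls y = c) ` Pow \<F>"
      unfolding lab_def cls_def by blast
    then show "finite (lab ` K)"
      using \<F>(1) by (meson finite_Pow_iff finite_imageI finite_subset)
    show "dist x y < e" if xy: "x \<in> K" "y \<in> K" "lab x = lab y" for x y
    proof -
      have "cls x = cls y"
        using lab xy by metis
      moreover obtain U where "U \<in> \<F>" "x \<in> U"
        using \<F>(2) xy by blast
      ultimately show ?thesis
        using \<F>(4) unfolding cls_def by blast
    qed
    show "continuous_on K lab"
      unfolding continuous_on_def
    proof
      fix x assume x: "x \<in> K"
      have "\<forall>\<^sub>F y in at x within K. y \<in> U \<longleftrightarrow> x \<in> U" if "U \<in> \<F>" for U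
      proof -
        have "openin (top_of_set K) (if x \<in> U then U else K - U)"
          using \<F>(3)[OF that] by (simp add: openin_diff)
        moreover have "x \<in> (if x \<in> U then U else K - U)"
          using x by simp
        ultimately have "\<forall>\<^sub>F y in at x within K. y \<in> (if x \<in> U then U else K - U)"
          by (rule eventually_at_within_openin)
        then show ?thesis
          by eventually_elim (simp split: if_splits)
      qed
      then have "\<forall>\<^sub>F y in at x within K. \<forall>U\<in>\<F>. y \<in> U \<longleftrightarrow> x \<in> U"
        using \<F>(1) by (simp add: eventually_ball_finite)
      then have "\<forall>\<^sub>F y in at x within K. lab y = lab x"
      proof eventually_elim
        case (elim y)
        then have "cls y = cls x"
          unfolding cls_def by blast
        then show ?case
          by (rule lab_cong)
      qed
      then show "(lab \<longlongrightarrow> lab x) (at x within K)"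
        by (rule tendsto_eventually)
    qed
  qed
qed

section \<open>Construction of the approximating homeomorphism\<close>

theorem theorem1p2:
  fixes K :: "'a::metric_space set" and T :: "'a \<Rightarrow> 'a" and \<epsilon> :: real
  assumes "cantor_set K"
    and "\<exists>S. homeomorphism K K T S"
    and "\<epsilon> > 0"
  shows "\<exists>T'. (\<exists>S'. homeomorphism K K T' S')
            \<and> (SUP x\<in>K. dist (T x) (T' x)) < \<epsilon>
            \<and> (\<forall>x\<in>K. periodic_orbit T' (omega_limit T' x))"
proof -
  have K: "compact K" "totally_disconnected K" "K \<noteq> {}"
    using assms(1) unfolding cantor_set_def by auto
  obtain S where T: "homeomorphism K K T S"
    using assms(2) by blast
  have T_img: "T ` K = K" and T_cont: "continuous_on K T"
    using T by (auto simp: homeomorphism_def)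
  \<comment> \<open>Half of \<open>\<epsilon>\<close> leaves room for a strict inequality after
    taking the supremum.\<close>
  obtain lab :: "'a \<Rightarrow> 'a" where lab: "continuous_on K lab" "finite (lab ` K)"
    "\<And>x y. x \<in> K \<Longrightarrow> y \<in> K \<Longrightarrow> lab x = lab y \<Longrightarrow> dist x y < \<epsilon> / 2"
    using finite_clopen_labelling[OF K(1,2), of "\<epsilon> / 2"] assms(3) by auto
  define E where "E = (\<lambda>x. (lab x, lab (T x))) ` K"
  have "E \<subseteq> lab ` K \<times> lab ` K"
    using T_img unfolding E_def by auto
  then have finE: "finite E"
    using lab(2) by (meson finite_SigmaI finite_subset)
  have "\<exists>j. (i, j) \<in> E" if "i \<in> lab ` K" for i
    using that unfolding E_def by blast
  then obtain s where "\<And>i. i \<in> lab ` K \<Longrightarrow> (i, s i) \<in> E"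
    by metis
  then have s: "(j, s j) \<in> E" if "(i, j) \<in> E" for i j
    using that \<open>E \<subseteq> lab ` K \<times> lab ` K\<close> by blast
  \<comment> \<open>Surjectivity of \<open>T\<close> gives every label a predecessor in
    \<open>E\<close>.\<close>
  have "lab ` K = (\<lambda>x. lab (T x)) ` K"
    by (metis T_img image_image)
  then have "\<exists>i. (i, j) \<in> E" if "j \<in> lab ` K" for j
    using that unfolding E_def by blast
  then obtain p where "\<And>j. j \<in> lab ` K \<Longrightarrow> (p j, j) \<in> E"
    by metis
  then have p: "(p i, i) \<in> E" if "(i, j) \<in> E" for i j
    using that \<open>E \<subseteq> lab ` K \<times> lab ` K\<close> by blast
  define Y where "Y = guided_paths E s p"
  define X where "X = Y \<times> K"
  \<comment> \<open>Every edge occurs at time 0 of some path, so \<open>X\<close> and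
    \<open>K\<close> carry the same set of label pairs, as the fibrewise matching requires.\<close>
  have edge_img: "(\<lambda>z. (fst z 0, fst z 1)) ` X = E"
  proof
    show "(\<lambda>z. (fst z 0, fst z 1)) ` X \<subseteq> E"
      unfolding X_def Y_def guided_paths_def by (auto dest!: spec[of _ "0::int"])
    show "E \<subseteq> (\<lambda>z. (fst z 0, fst z 1)) ` X"
    proof
      fix e assume e: "e \<in> E"
      obtain i j where ij: "e = (i, j)"
        by (cases e)
      obtain y where "y \<in> Y" "y 0 = i" "y 1 = j"
        unfolding Y_def using guided_path_through_edge[of i j E s p] s p e ij by metis
      moreover obtain x where "x \<in> K"
        using K(3) by blast
      ultimately show "e \<in> (\<lambda>z. (fst z 0, fst z 1)) ` X"
        unfolding X_def ij by (intro image_eqI[of _ _ "(y, x)"]) auto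
    qed
  qed
  have "E \<noteq> {}"
    using K(3) by (simp add: E_def)
  then have "Y \<noteq> {}"
    using edge_img by (auto simp: X_def)
  then have X: "cantor_set X"
    unfolding X_def Y_def
    using cantor_set_Times compact_guided_paths[OF finE] totally_disconnected_guided_paths[OF finE] assms(1)
    by metis
  have "continuous_on X (\<lambda>z. fst z k)" for k
    using continuous_on_fst[OF continuous_on_id] by (rule continuous_on_product_then_coordinatewise)
  then have "continuous_on X (\<lambda>z. (fst z 0, fst z 1))"
    by (intro continuous_on_Pair)
  moreover have "continuous_on K (\<lambda>x. (lab x, lab (T x)))"
    using lab(1) T_cont T_img
    by (intro continuous_on_Pair continuous_on_compose2[OF lab(1) T_cont]) auto
  ultimately obtain \<phi> \<psi> where \<phi>: "homeomorphism X K \<phi> \<psi>"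
    and edge: "\<And>z. z \<in> X \<Longrightarrow> (lab (\<phi> z), lab (T (\<phi> z))) = (fst z 0, fst z 1)"
    using cantor_set_homeomorphism_over_labels[OF X _ assms(1), where f = "\<lambda>z. (fst z 0, fst z 1)"
        and g = "\<lambda>x. (lab x, lab (T x))"] edge_img finE E_def by metis
  \<comment> \<open>The shift moves the path, while the second coordinate stays fixed and so does
    not affect asymptotic behaviour.\<close>
  define \<tau> where "\<tau> z = (shift (fst z), snd z)" for z :: "(int \<Rightarrow> 'a) \<times> 'a"
  have \<tau>_pow: "(\<tau> ^^ n) (y, x) = ((shift ^^ n) y, x)" for n y x
    by (induction n) (simp_all add: \<tau>_def)
  have \<tau>_img: "\<tau> ` X = X"
  proof -
    have "\<tau> ` X = (shift ` Y) \<times> K"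
      unfolding X_def \<tau>_def by force
    then show ?thesis
      unfolding X_def Y_def shift_guided_paths .
  qed
  have \<tau>_mem: "(\<tau> ^^ n) z \<in> X" if "z \<in> X" for n z
    using that \<tau>_img by (induction n) auto
  have "inj_on \<tau> X"
  proof (rule inj_onI)
    fix u v assume "\<tau> u = \<tau> v"
    then have "shift (fst u) (k - 1) = shift (fst v) (k - 1)" "snd u = snd v" for k
      by (auto simp: \<tau>_def)
    then show "u = v"
      by (auto simp: shift_def prod_eq_iff fun_eq_iff)
  qed
  moreover have "continuous_on X \<tau>"
    unfolding \<tau>_def
    by (intro continuous_on_Pair continuous_on_compose2[OF continuous_on_shift[of UNIV]]
        continuous_on_fst continuous_on_snd continuous_on_id) auto
  moreover have "compact X"
    using X by (simp add: cantor_set_def)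
  ultimately obtain \<sigma> where \<tau>: "homeomorphism X X \<tau> \<sigma>"
    using homeomorphism_compact \<tau>_img by metis
  define T' where "T' = \<phi> \<circ> (\<tau> \<circ> \<psi>)"
  have "\<exists>S'. homeomorphism K K T' S'"
    unfolding T'_def
    using homeomorphism_compose[OF homeomorphism_compose[OF homeomorphism_symD[OF \<phi>] \<tau>] \<phi>] by blast
  have \<phi>_mem: "\<phi> z \<in> K" if "z \<in> X" for z
    using that homeomorphism_image1[OF \<phi>] by blast
  have T'_pow: "(T' ^^ n) (\<phi> z) = \<phi> ((\<tau> ^^ n) z)" if "z \<in> X" for n z
    by (induction n) (simp_all add: T'_def homeomorphism_apply1[OF \<phi> \<tau>_mem[OF that]])
  have ex: "\<exists>z\<in>X. x = \<phi> z" if "x \<in> K" for x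
    using that homeomorphism_image1[OF \<phi>] by blast
  have "dist (T x) (T' x) \<le> \<epsilon> / 2" if x: "x \<in> K" for x
  proof -
    obtain z where z: "z \<in> X" "x = \<phi> z"
      using ex x by blast
    have T'x: "T' x = \<phi> (\<tau> z)" and \<tau>z: "\<tau> z \<in> X"
      using T'_pow[OF z(1), of 1] \<tau>_mem[OF z(1), of 1] z by simp_all
    \<comment> \<open>The key to closeness: the label of \<open>T x\<close> is the time-1 vertex of
      the path of \<open>z\<close>. Shifting makes it the time-0 vertex of \<open>\<tau> z\<close>,
      which is the label of \<open>\<phi> (\<tau> z) = T' x\<close>.\<close>
    have "lab (T x) = fst z 1"
      using edge[OF z(1)] z by simp
    also have "\<dots> = lab (T' x)"
      using edge[OF \<tau>z] T'x by (simp add: \<tau>_def shift_def)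
    finally have "lab (T x) = lab (T' x)" .
    moreover have "T x \<in> K" "T' x \<in> K"
      using x T_img T'x \<phi>_mem[OF \<tau>z] by auto
    ultimately show ?thesis
      using lab(3) less_imp_le by blast
  qed
  then have "(SUP x\<in>K. dist (T x) (T' x)) \<le> \<epsilon> / 2"
    using K(3) by (intro cSUP_least) auto
  then have "(SUP x\<in>K. dist (T x) (T' x)) < \<epsilon>"
    using assms(3) by linarith
  moreover have "periodic_orbit T' (omega_limit T' x)" if x: "x \<in> K" for x
  proof -
    obtain y a where ya: "y \<in> Y" "a \<in> K" "x = \<phi> (y, a)"
      using ex[OF x] unfolding X_def by blast
    \<comment> \<open>Replace the path of \<open>x\<close> by its periodic companion and keep
      \<open>a\<close>: the point \<open>\<phi> (w, a)\<close> is then periodic under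
      \<open>T'\<close>.\<close>
    obtain w N and m :: nat where w: "w \<in> Y" "m > 0" "(shift ^^ m) w = w" "\<And>k. k \<ge> N \<Longrightarrow> y k = w k"
      using guided_path_asymptotic_periodic[OF finE] ya(1) unfolding Y_def by metis
    have yX: "(y, a) \<in> X" and wX: "(w, a) \<in> X"
      using ya w by (auto simp: X_def)
    have per: "(T' ^^ m) (\<phi> (w, a)) = \<phi> (w, a)"
      using T'_pow[OF wX] by (simp add: \<tau>_pow w(3))
    \<comment> \<open>Uniform continuity, from compactness of \<open>X\<close>, carries the
      convergence of distances to 0 through \<open>\<phi>\<close>.\<close>
    have "uniformly_continuous_on X \<phi>"
      using compact_uniformly_continuous homeomorphism_cont1[OF \<phi>] \<open>compact X\<close> by blast
    moreover have "(\<lambda>n. dist ((\<tau> ^^ n) (y, a)) ((\<tau> ^^ n) (w, a))) \<longlonglongrightarrow> 0"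
      using shift_asymptotic[OF w(4)] by (simp add: \<tau>_pow dist_Pair_Pair)
    ultimately have "(\<lambda>n. dist (\<phi> ((\<tau> ^^ n) (y, a))) (\<phi> ((\<tau> ^^ n) (w, a)))) \<longlonglongrightarrow> 0"
      using \<tau>_mem[OF yX] \<tau>_mem[OF wX] unfolding uniformly_continuous_on_sequentially
      by (auto dest!: spec2[where x = "\<lambda>n. (\<tau> ^^ n) (y, a)" and y = "\<lambda>n. (\<tau> ^^ n) (w, a)"])
    then have "omega_limit T' x = orbit T' (\<phi> (w, a))"
      using T'_pow[OF yX] T'_pow[OF wX] ya(3) w(2) per
      by (intro omega_limit_eq_orbit_if_asymptotic[of m]) auto
    then show ?thesis
      using per w(2) unfolding periodic_orbit_def by blast
  qed
  ultimately show ?thesis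
    using \<open>\<exists>S'. homeomorphism K K T' S'\<close> by blast
qed

end
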